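(* Let $\mathcal{H}$ be a complex Hilbert space, $S \in \mathcal{L}(\mathcal{H})$, $0<q<1$, $0\le\alpha\le 1$ and $r\ge 1$. Then $$w_q^{2r}(S) \le q^2\left\|\alpha|S|^{2r}+(1-\alpha)|S^*|^{2r}\right\| + (1-q^2)\left(\alpha\left\||S|^{2r}\right\|+(1-\alpha)\left\||S^*|^{2r}\right\|\right) + 2q\sqrt{1-q^2}\,\left\||S^*|^{2r(1-\alpha)}\right\|\,\left\||S|^{2r\alpha}\right\|.$$
   Context: $\mathcal{L}(\mathcal{H})$ is the algebra of bounded linear operators on the complex Hilbert space $\mathcal{H}$, with operator norm $\|\cdot\|$; $|S|=(S^*S)^{1/2}$ and $|S^*|=(SS^* )^{1/2}$, and the zeroth power of a positive operator is the identity $I$. For $q\in\mathbb{C}$ with $|q|\le 1$, the $q$-numerical radius is $w_q(T)=\sup\{|\langle Tx,y\rangle| : x,y\in\mathcal{H},\ \|x\|=\|y\|=1,\ \langle x,y\rangle=q\}$, and $w_q^{2r}(S)$ means $(w_q(S))^{2r}$. When $|q|<1$ it is understood that $\dim\mathcal{H}\ge 2$, so that this supremum is over a nonempty set. *)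

theory Defs
  imports "HOL-Analysis.Analysis" "HOL-Computational_Algebra.Polynomial"
begin

(* The inner product is linear in the first argument and conjugate-linear in the second.
   Completeness and the compatibility of the norm with the real scalars come from banach. *)
class complex_hilbert = banach +
  fixes scaleC :: "complex \<Rightarrow> 'a \<Rightarrow> 'a"  (infixr "*\<^sub>C" 75)
    and cinner :: "'a \<Rightarrow> 'a \<Rightarrow> complex"
  assumes scaleC_add_right: "a *\<^sub>C (x + y) = a *\<^sub>C x + a *\<^sub>C y"
    and scaleC_add_left: "(a + b) *\<^sub>C x = a *\<^sub>C x + b *\<^sub>C x"
    and scaleC_scaleC: "a *\<^sub>C b *\<^sub>C x = (a * b) *\<^sub>C x"
    and scaleC_of_real: "complex_of_real r *\<^sub>C x = r *\<^sub>R x"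
    and cinner_commute: "cinner x y = cnj (cinner y x)"
    and cinner_add_left: "cinner (x + y) z = cinner x z + cinner y z"
    and cinner_scaleC_left: "cinner (a *\<^sub>C x) y = a * cinner x y"
    and cinner_self: "cinner x x = complex_of_real ((norm x)\<^sup>2)"

lemma scaleC_one: "1 *\<^sub>C x = (x :: 'a::complex_hilbert)"
  using scaleC_of_real[of 1 x] by simp

interpretation complex_vector: vector_space "scaleC :: complex \<Rightarrow> 'a \<Rightarrow> 'a::complex_hilbert"
  by unfold_locales (simp_all add: scaleC_add_right scaleC_add_left scaleC_scaleC scaleC_one)

(* The library type of bounded operators only records real linearity. Its norm is the
   operator norm, which does not depend on the scalar field. *)
definition complex_linear_op :: "('a::complex_hilbert \<Rightarrow>\<^sub>L 'a) \<Rightarrow> bool" where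
  "complex_linear_op T \<longleftrightarrow> (\<forall>c x. blinfun_apply T (c *\<^sub>C x) = c *\<^sub>C blinfun_apply T x)"

definition cadjoint :: "('a::complex_hilbert \<Rightarrow>\<^sub>L 'a) \<Rightarrow> ('a \<Rightarrow>\<^sub>L 'a)" where
  "cadjoint T =
    (THE R. \<forall>x y. cinner (blinfun_apply T x) y = cinner x (blinfun_apply R y))"

definition op_poly :: "real poly \<Rightarrow> ('a::complex_hilbert \<Rightarrow>\<^sub>L 'a) \<Rightarrow> ('a \<Rightarrow>\<^sub>L 'a)" where
  "op_poly p A = (\<Sum>i\<le>degree p. coeff p i *\<^sub>R ((\<lambda>B. A o\<^sub>L B) ^^ i) id_blinfun)"

(* Continuous functional calculus at t^s for a positive operator A, whose spectrum lies in
   [0, norm A]: the norm limit of p_n(A) for real polynomials p_n converging to t^s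
   uniformly on that interval. The case s = 0 is separate because 0 powr 0 = 0 in the
   library, whereas the zeroth power of a positive operator is the identity. *)
definition op_powr :: "('a::complex_hilbert \<Rightarrow>\<^sub>L 'a) \<Rightarrow> real \<Rightarrow> ('a \<Rightarrow>\<^sub>L 'a)" where
  "op_powr A s =
    (THE B. \<forall>p :: nat \<Rightarrow> real poly.
       uniform_limit {0..norm A} (\<lambda>n. poly (p n)) (\<lambda>t. if s = 0 then 1 else t powr s) sequentially
       \<longrightarrow> (\<lambda>n. op_poly (p n) A) \<longlonglongrightarrow> B)"

definition op_abs :: "('a::complex_hilbert \<Rightarrow>\<^sub>L 'a) \<Rightarrow> ('a \<Rightarrow>\<^sub>L 'a)" where
  "op_abs T = op_powr (cadjoint T o\<^sub>L T) (1 / 2)"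

definition q_numerical_radius :: "complex \<Rightarrow> ('a::complex_hilbert \<Rightarrow>\<^sub>L 'a) \<Rightarrow> real" where
  "q_numerical_radius q T =
    Sup {cmod (cinner (blinfun_apply T x) y) | x y.
           norm x = 1 \<and> norm y = 1 \<and> cinner x y = q}"

end

theory Submission
  imports Defs "HOL-Computational_Algebra.Fundamental_Theorem_Algebra"
begin

text \<open>
  If \<open>x\<close>, \<open>y\<close> are unit vectors, \<open>|\<langle>Sx, y\<rangle>|\<close> is at most both \<open>\<parallel>Sx\<parallel>\<close> and \<open>\<parallel>S\<^sup>* y\<parallel>\<close>. By the operator
  Jensen inequality, \<open>\<parallel>Sx\<parallel>\<close> to the power \<open>2r\<close> is at most \<open>\<langle>Ax, x\<rangle>\<close> with \<open>A\<close> the power \<open>2r\<close> of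
  \<open>|S|\<close>, and likewise for \<open>S\<^sup>*\<close>, \<open>y\<close> and the power \<open>B\<close> of \<open>|S\<^sup>*|\<close>. So the power \<open>2r\<close> of
  \<open>|\<langle>Sx, y\<rangle>|\<close> is at most \<open>\<alpha> \<langle>Ax, x\<rangle> + (1 - \<alpha>) \<langle>By, y\<rangle>\<close>, and no mixed Schwarz inequality is
  needed. Expanding \<open>y = q x + sqrt (1 - q\<^sup>2) z\<close> with a unit vector \<open>z\<close> orthogonal to \<open>x\<close> gives the
  bound, because \<open>\<parallel>B\<parallel>\<close> is the product of the two norms in the last summand: both sides are the
  power \<open>2r\<close> of \<open>\<parallel>S\<parallel>\<close>.

  The functional calculus rests on the inequality \<open>\<parallel>p(A)\<parallel> \<le> sup |p|\<close> over \<open>[0, \<parallel>A\<parallel>]\<close> for real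
  polynomials \<open>p\<close> and positive \<open>A\<close>: if \<open>N = \<parallel>p(A)\<parallel>\<close> exceeded the supremum, \<open>N\<^sup>2 - p\<^sup>2\<close> would have
  no zero on the interval, so \<open>N\<^sup>2 - p(A)\<^sup>2\<close> would be bounded below.
\<close>

section \<open>Complex inner products\<close>

lemma cinner_add_right: "cinner x (y + z) = cinner x y + cinner (x :: 'a::complex_hilbert) z"
  by (metis cinner_add_left cinner_commute complex_cnj_add)

lemma cinner_scaleC_right: "cinner x (a *\<^sub>C y) = cnj a * cinner (x :: 'a::complex_hilbert) y"
  by (metis cinner_commute cinner_scaleC_left complex_cnj_mult)

lemma cinner_scaleR_left: "cinner (a *\<^sub>R x) y = a *\<^sub>R cinner (x :: 'a::complex_hilbert) y"
  by (simp add: scaleC_of_real[symmetric] cinner_scaleC_left scaleR_conv_of_real)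

lemma cinner_scaleR_right: "cinner x (a *\<^sub>R y) = a *\<^sub>R cinner (x :: 'a::complex_hilbert) y"
  by (simp add: scaleC_of_real[symmetric] cinner_scaleC_right scaleR_conv_of_real)

lemma cinner_minus_left: "cinner (- x) y = - cinner (x :: 'a::complex_hilbert) y"
  using cinner_scaleR_left[of "-1" x y] by simp

lemma cinner_minus_right: "cinner x (- y) = - cinner (x :: 'a::complex_hilbert) y"
  using cinner_scaleR_right[of x "-1" y] by simp

lemma cinner_diff_left: "cinner (x - y) z = cinner x z - cinner (y :: 'a::complex_hilbert) z"
  using cinner_add_left[of x "- y" z] by (simp add: cinner_minus_left)

lemma cinner_diff_right: "cinner x (y - z) = cinner x y - cinner (x :: 'a::complex_hilbert) z"
  using cinner_add_right[of x y "- z"] by (simp add: cinner_minus_right)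

lemma cinner_zero_left [simp]: "cinner 0 (y :: 'a::complex_hilbert) = 0"
  using cinner_scaleR_left[of 0 0 y] by simp

lemma cinner_zero_right [simp]: "cinner (y :: 'a::complex_hilbert) 0 = 0"
  using cinner_scaleR_right[of y 0 0] by simp

lemmas cinner_simps = cinner_add_left cinner_add_right cinner_diff_left cinner_diff_right
  cinner_scaleR_left cinner_scaleR_right cinner_scaleC_left cinner_scaleC_right
  cinner_minus_left cinner_minus_right

lemma Re_cinner_self: "Re (cinner x x) = (norm (x :: 'a::complex_hilbert))\<^sup>2"
  by (simp add: cinner_self)

lemma Re_cinner_commute: "Re (cinner x y) = Re (cinner y (x :: 'a::complex_hilbert))"
  by (subst cinner_commute) simp

lemma norm_add_squared:
  "(norm (x + y))\<^sup>2 = (norm x)\<^sup>2 + 2 * Re (cinner x y) + (norm (y :: 'a::complex_hilbert))\<^sup>2"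
  using Re_cinner_commute[of x y]
  by (simp add: Re_cinner_self[symmetric] cinner_simps)

lemma norm_diff_squared:
  "(norm (x - y))\<^sup>2 = (norm x)\<^sup>2 - 2 * Re (cinner x y) + (norm (y :: 'a::complex_hilbert))\<^sup>2"
  using norm_add_squared[of x "- y"] by (simp add: cinner_minus_right)

lemma norm_scaleC: "norm (a *\<^sub>C x) = cmod a * norm (x :: 'a::complex_hilbert)"
proof -
  have "complex_of_real ((norm (a *\<^sub>C x))\<^sup>2) = a * cnj a * complex_of_real ((norm x)\<^sup>2)"
    by (simp only: cinner_self[symmetric] cinner_simps mult_ac)
  also have "\<dots> = complex_of_real ((cmod a * norm x)\<^sup>2)"
    by (simp only: complex_norm_square[symmetric] of_real_mult[symmetric] power_mult_distrib)
  finally have "(norm (a *\<^sub>C x))\<^sup>2 = (cmod a * norm x)\<^sup>2" by (simp only: of_real_eq_iff)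
  then show ?thesis by (simp add: power2_eq_iff_nonneg)
qed

text \<open>The norm is already known to satisfy the triangle inequality; squaring it leaves exactly
  the cross terms.\<close>

lemma Re_cinner_le: "Re (cinner x y) \<le> norm x * norm (y :: 'a::complex_hilbert)"
proof -
  have "(norm (x + y))\<^sup>2 \<le> (norm x + norm y)\<^sup>2"
    by (intro power_mono norm_triangle_ineq) auto
  then show ?thesis by (simp add: norm_add_squared power2_sum)
qed

text \<open>Multiplying \<open>x\<close> by the conjugate of the inner product makes the inner
  product real and nonnegative, so the real version applies.\<close>

lemma cmod_cinner_le: "cmod (cinner x y) \<le> norm x * norm (y :: 'a::complex_hilbert)"
proof (cases "cinner x y = 0")
  case False
  define c where "c = cinner x y"
  have "(cmod c)\<^sup>2 = Re (cinner (cnj c *\<^sub>C x) y)"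
    by (simp add: cinner_simps c_def cmod_power2) (simp add: power2_eq_square)
  also have "\<dots> \<le> cmod c * (norm x * norm y)"
    using Re_cinner_le[of "cnj c *\<^sub>C x" y] by (simp add: norm_scaleC)
  finally show ?thesis using False by (simp add: power2_eq_square c_def)
qed auto

lemma abs_Re_cinner_le: "\<bar>Re (cinner x y)\<bar> \<le> norm x * norm (y :: 'a::complex_hilbert)"
  using cmod_cinner_le[of x y] abs_Re_le_cmod[of "cinner x y"] by linarith

lemma Re_cinner_blinfun_le:
  assumes "norm x = 1" "norm y = 1"
  shows "Re (cinner (blinfun_apply B x) y) \<le> norm (B :: 'a::complex_hilbert \<Rightarrow>\<^sub>L 'a)"
  using Re_cinner_le[of "blinfun_apply B x" y] norm_blinfun[of B x] assms by simp

lemma cinner_ext_Re: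
  assumes "\<And>x. Re (cinner x y) = Re (cinner x z)"
  shows "y = (z :: 'a::complex_hilbert)"
proof -
  have "Re (cinner (y - z) (y - z)) = 0"
    using assms[of "y - z"] by (simp add: cinner_diff_right)
  then show ?thesis by (simp add: Re_cinner_self)
qed

text \<open>The imaginary part at \<open>x\<close> is, up to sign, the real part at
  \<open>\<i> *\<^sub>C x\<close>. This lets the later arguments work with real functionals
  only.\<close>

lemma Re_cinner_complex_linear_eqI:
  assumes "\<And>x. Re (cinner (f x) y) = Re (cinner x z)"
    and "\<And>c x. f (c *\<^sub>C x) = c *\<^sub>C f x"
  shows "cinner (f x) y = cinner x (z :: 'a::complex_hilbert)"
proof (rule complex_eqI)
  show "Re (cinner (f x) y) = Re (cinner x z)" by fact
  show "Im (cinner (f x) y) = Im (cinner x z)"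
    using assms(1)[of "\<i> *\<^sub>C x"] by (simp add: assms(2) cinner_simps)
qed

lemma bounded_linear_Re_cinner: "bounded_linear (\<lambda>x. Re (cinner x (y :: 'a::complex_hilbert)))"
  by (rule bounded_linear_intro[where K = "norm y"])
    (auto simp: cinner_simps intro: abs_Re_cinner_le)

section \<open>Adjoints\<close>

text \<open>The vector \<open>z\<close> is the minimiser of \<open>J\<close>: if \<open>g\<close> is
  represented by \<open>z\<close>, then \<open>J x\<close> is the squared distance from
  \<open>x\<close> to \<open>z\<close> minus a constant. A minimising sequence is Cauchy, and the
  first variation of \<open>J\<close> at its limit vanishes.\<close>

theorem Riesz_representation:
  fixes g :: "'a::complex_hilbert \<Rightarrow> real"
  assumes "bounded_linear g"
  obtains z where "\<And>x. g x = Re (cinner x z)"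
proof -
  interpret g: bounded_linear g by fact
  define J where "J x = (norm x)\<^sup>2 - 2 * g x" for x
  define m where "m = Inf (range J)"
  obtain K where K: "\<And>x. \<bar>g x\<bar> \<le> norm x * K" using g.bounded by auto
  have "- K\<^sup>2 \<le> J x" for x
  proof -
    have "0 \<le> (norm x - K)\<^sup>2" by simp
    then show ?thesis using K[of x] by (simp add: J_def power2_diff algebra_simps)
  qed
  then have bdd: "bdd_below (range J)" by (intro bdd_belowI2)
  have m_le: "m \<le> J x" for x unfolding m_def using bdd by (intro cInf_lower) auto
  have "\<exists>x. J x < m + inverse (real (Suc n))" for n
    using cInf_lessD[of "range J" "m + inverse (real (Suc n))"] unfolding m_def[symmetric]
    by auto
  then obtain X where X: "\<And>n. J (X n) < m + inverse (real (Suc n))" by metis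
  \<comment> \<open>Parallelogram law: the value of \<open>J\<close> at the midpoint is at least
    \<open>m\<close>, which forces almost minimal points to be close together.\<close>
  have near: "(norm (x - y))\<^sup>2 \<le> 2 * (J x - m) + 2 * (J y - m)" for x y
  proof -
    have "4 * J ((1/2) *\<^sub>R (x + y)) = (norm (x + y))\<^sup>2 - 4 * (g x + g y)"
      unfolding J_def g.scaleR g.add norm_scaleR power_mult_distrib
      by (simp add: power2_eq_square field_simps)
    then show ?thesis
      using m_le[of "(1/2) *\<^sub>R (x + y)"]
      by (simp add: J_def norm_add_squared norm_diff_squared)
  qed
  have "Cauchy X"
  proof (rule metric_CauchyI)
    fix e :: real assume e: "0 < e"
    then obtain N where N: "N > 0" "inverse (real N) < e\<^sup>2 / 4"
      using ex_inverse_of_nat_less[of "e\<^sup>2 / 4"] by auto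
    have "dist (X i) (X j) < e" if "i \<ge> N" "j \<ge> N" for i j
    proof -
      have "inverse (real (Suc k)) \<le> inverse (real N)" if "k \<ge> N" for k
        using N that by (intro le_imp_inverse_le) auto
      then have small: "J (X k) < m + e\<^sup>2 / 4" if "k \<ge> N" for k
        using X[of k] N(2) that by fastforce
      have "(norm (X i - X j))\<^sup>2 < e\<^sup>2"
        using near[of "X i" "X j"] small[OF that(1)] small[OF that(2)] by argo
      then show ?thesis using e by (simp add: dist_norm power2_less_imp_less)
    qed
    then show "\<exists>M. \<forall>i\<ge>M. \<forall>j\<ge>M. dist (X i) (X j) < e" by blast
  qed
  then obtain z where z: "X \<longlonglongrightarrow> z" using Cauchy_convergent_iff convergent_def by blast
  have "J z \<le> m"
  proof (rule LIMSEQ_le)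
    show "(\<lambda>n. J (X n)) \<longlonglongrightarrow> J z" unfolding J_def by (intro tendsto_intros g.tendsto z)
    show "(\<lambda>n. m + inverse (real (Suc n))) \<longlonglongrightarrow> m"
      using tendsto_add[OF tendsto_const[of m] LIMSEQ_inverse_real_of_nat] by simp
    show "\<exists>N. \<forall>n\<ge>N. J (X n) \<le> m + inverse (real (Suc n))" using X less_imp_le by blast
  qed
  have "g x = Re (cinner x z)" for x
  proof -
    define d where "d = Re (cinner x z) - g x"
    define s where "s = (norm x)\<^sup>2"
    have s: "0 \<le> s" by (simp add: s_def)
    have pos: "0 \<le> 2 * t * d + t\<^sup>2 * s" for t
    proof -
      have "J (z + t *\<^sub>R x) = J z + (2 * t * d + t\<^sup>2 * s)"
        unfolding J_def d_def s_def norm_add_squared g.add g.scaleR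
        using Re_cinner_commute[of z x]
        by (simp add: cinner_simps power_mult_distrib algebra_simps)
      then show ?thesis using \<open>J z \<le> m\<close> m_le[of "z + t *\<^sub>R x"] by linarith
    qed
    \<comment> \<open>The quadratic in \<open>t\<close> is tested at \<open>t = - w * d\<close>.
      This \<open>w\<close> keeps \<open>w * s\<close> at most 1, also when \<open>s = 0\<close>, so
      the quadratic is negative there unless \<open>d = 0\<close>.\<close>
    define w where "w = 1 / (1 + s)"
    have w: "0 < w" "w * s \<le> 1" using s by (auto simp: w_def divide_simps)
    have "0 \<le> - (d\<^sup>2 * (w * (2 - w * s)))"
      using pos[of "- w * d"] by (simp add: power2_eq_square algebra_simps)
    moreover have "0 < w * (2 - w * s)" using w by simp
    ultimately have "d = 0" 
      by (metis mult_pos_pos neg_0_le_iff_le not_le zero_less_power2)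
    then show ?thesis by (simp add: d_def)
  qed
  then show thesis using that by blast
qed

text \<open>For fixed \<open>y\<close>, Riesz represents the real functional sending
  \<open>x\<close> to the real part of the inner product of \<open>T x\<close> and \<open>y\<close>;
  complex linearity of \<open>T\<close> upgrades this to the complex identity. Testing at
  \<open>R y\<close> itself bounds \<open>R\<close>.\<close>

lemma cadjoint_exists:
  fixes T :: "'a::complex_hilbert \<Rightarrow>\<^sub>L 'a"
  assumes T: "complex_linear_op T"
  shows "\<exists>R. \<forall>x y. cinner (blinfun_apply T x) y = cinner x (blinfun_apply R y)"
proof -
  have "\<exists>z. \<forall>x. cinner (blinfun_apply T x) y = cinner x z" for y
  proof -
    have "bounded_linear (\<lambda>x. Re (cinner (blinfun_apply T x) y))"
      using bounded_linear_compose[OF bounded_linear_Re_cinner blinfun.bounded_linear_right] .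
    then obtain z where "\<And>x. Re (cinner (blinfun_apply T x) y) = Re (cinner x z)"
      using Riesz_representation by blast
    then show ?thesis
      using Re_cinner_complex_linear_eqI T unfolding complex_linear_op_def by blast
  qed
  then obtain R where R: "\<And>x y. cinner (blinfun_apply T x) y = cinner x (R y)" by metis
  have "bounded_linear R"
  proof (rule bounded_linear_intro[where K = "norm T"])
    show "R (x + y) = R x + R y" for x y
      by (rule cinner_ext_Re) (simp add: R[symmetric] cinner_simps)
    show "R (c *\<^sub>R x) = c *\<^sub>R R x" for c x
      by (rule cinner_ext_Re) (simp add: R[symmetric] cinner_simps)
    show "norm (R y) \<le> norm y * norm T" for y
    proof (cases "R y = 0")
      case False
      have "(norm (R y))\<^sup>2 = Re (cinner (blinfun_apply T (R y)) y)"
        by (simp add: R Re_cinner_self)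
      also have "\<dots> \<le> norm T * norm (R y) * norm y"
        using Re_cinner_le norm_blinfun mult_right_mono norm_ge_zero by (meson order_trans)
      finally show ?thesis using False by (simp add: power2_eq_square mult.commute mult.left_commute)
    qed auto
  qed
  then show ?thesis using R by (metis bounded_linear_Blinfun_apply)
qed

lemma cadjoint_eqI:
  assumes "\<And>x y. cinner (blinfun_apply T x) y = cinner x (blinfun_apply R y)"
  shows "cadjoint T = R"
  unfolding cadjoint_def
proof (rule the_equality)
  fix R' assume "\<forall>x y. cinner (blinfun_apply T x) y = cinner x (blinfun_apply R' y)"
  then show "R' = R" using assms by (intro blinfun_eqI cinner_ext_Re) metis
qed (use assms in auto)

lemma cinner_cadjoint:
  assumes "complex_linear_op T"
  shows "cinner (blinfun_apply T x) y = cinner x (blinfun_apply (cadjoint T) y)"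
  using cadjoint_exists[OF assms] cadjoint_eqI by metis

lemma cinner_cadjoint':
  assumes "complex_linear_op T"
  shows "cinner (blinfun_apply (cadjoint T) x) y = cinner x (blinfun_apply T y)"
  by (metis assms cinner_cadjoint cinner_commute)

lemma cadjoint_cadjoint: "complex_linear_op T \<Longrightarrow> cadjoint (cadjoint T) = T"
  by (intro cadjoint_eqI cinner_cadjoint')

lemma complex_linear_op_cadjoint:
  assumes "complex_linear_op T"
  shows "complex_linear_op (cadjoint T)"
  unfolding complex_linear_op_def
  by (intro allI cinner_ext_Re) (simp add: cinner_simps cinner_cadjoint[OF assms, symmetric])

lemma norm_cadjoint_le:
  assumes T: "complex_linear_op T"
  shows "norm (cadjoint T) \<le> norm T"
proof (rule norm_blinfun_bound)
  fix y
  let ?z = "blinfun_apply (cadjoint T) y"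
  show "norm ?z \<le> norm T * norm y"
  proof (cases "?z = 0")
    case False
    have "(norm ?z)\<^sup>2 = Re (cinner (blinfun_apply T ?z) y)"
      by (simp add: cinner_cadjoint[OF T] Re_cinner_self)
    also have "\<dots> \<le> norm T * norm ?z * norm y"
      using Re_cinner_le norm_blinfun mult_right_mono norm_ge_zero by (meson order_trans)
    finally show ?thesis using False by (simp add: power2_eq_square mult.commute mult.left_commute)
  qed auto
qed simp

lemma norm_cadjoint: "complex_linear_op T \<Longrightarrow> norm (cadjoint T) = norm T"
  using norm_cadjoint_le[of T] norm_cadjoint_le[of "cadjoint T"]
  by (simp add: cadjoint_cadjoint complex_linear_op_cadjoint)

section \<open>Polynomials of a positive operator\<close>

text \<open>Symmetry makes the quadratic form real, so the real part in the last clause loses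
  nothing.\<close>

definition positive_op :: "('a::complex_hilbert \<Rightarrow>\<^sub>L 'a) \<Rightarrow> bool" where
  "positive_op A \<longleftrightarrow> complex_linear_op A
     \<and> (\<forall>x y. cinner (blinfun_apply A x) y = cinner x (blinfun_apply A y))
     \<and> (\<forall>x. 0 \<le> Re (cinner (blinfun_apply A x) x))"

lemma positive_op_cinner:
  "positive_op A \<Longrightarrow> cinner (blinfun_apply A x) y = cinner x (blinfun_apply A y)"
  and positive_op_ge_0: "positive_op A \<Longrightarrow> 0 \<le> Re (cinner (blinfun_apply A x) x)"
  and positive_op_complex_linear: "positive_op A \<Longrightarrow> complex_linear_op A"
  by (auto simp: positive_op_def)

text \<open>Horner's scheme for a polynomial in \<open>A\<close>, applied to a vector. Complex
  coefficients are allowed because a real polynomial is to be split into linear factors, whose roots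
  may be complex.\<close>

definition cpoly_apply :: "('a::complex_hilbert \<Rightarrow>\<^sub>L 'a) \<Rightarrow> complex poly \<Rightarrow> 'a \<Rightarrow> 'a" where
  "cpoly_apply A p = fold_coeffs (\<lambda>a f x. a *\<^sub>C x + blinfun_apply A (f x)) p (\<lambda>x. 0)"

lemma cpoly_apply_0 [simp]: "cpoly_apply A 0 x = 0"
  by (simp add: cpoly_apply_def)

lemma cpoly_apply_pCons [simp]:
  "cpoly_apply A (pCons a p) x = a *\<^sub>C x + blinfun_apply A (cpoly_apply A p x)"
  by (cases "p = 0 \<and> a = 0") (auto simp: cpoly_apply_def blinfun.bilinear_simps)

lemma cpoly_apply_add: "cpoly_apply A (p + q) x = cpoly_apply A p x + cpoly_apply A q x"
  by (induction p q rule: poly_induct2)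
    (simp_all add: scaleC_add_left blinfun.bilinear_simps)

lemma cpoly_apply_smult:
  assumes "complex_linear_op A"
  shows "cpoly_apply A (smult c p) x = c *\<^sub>C cpoly_apply A p x"
  using assms
  by (induction p) (simp_all add: scaleC_add_right scaleC_scaleC complex_linear_op_def)

lemma cpoly_apply_mult:
  assumes "complex_linear_op A"
  shows "cpoly_apply A (p * q) x = cpoly_apply A p (cpoly_apply A q x)"
  by (induction p) (simp_all add: cpoly_apply_add cpoly_apply_smult[OF assms])

text \<open>A substitute for invertibility: the \<open>z\<close> for which \<open>A - z\<close>
  fails this form the approximate point spectrum of \<open>A\<close>.\<close>

definition bounded_below :: "('a::real_normed_vector \<Rightarrow> 'b::real_normed_vector) \<Rightarrow> bool" where
  "bounded_below f \<longleftrightarrow> (\<exists>c>0. \<forall>x. c * norm x \<le> norm (f x))"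

lemma bounded_below_comp:
  assumes "bounded_below f" "bounded_below g"
  shows "bounded_below (\<lambda>x. f (g x))"
proof -
  obtain c d where c: "c > 0" "\<And>x. c * norm x \<le> norm (f x)"
    and d: "d > 0" "\<And>x. d * norm x \<le> norm (g x)"
    using assms unfolding bounded_below_def by blast
  have "c * d * norm x \<le> norm (f (g x))" for x
    using order_trans[OF mult_left_mono[OF d(2)[of x], of c] c(2)[of "g x"]] c(1)
    by (simp add: mult.assoc)
  then show ?thesis unfolding bounded_below_def
    using c(1) d(1) by (intro exI[of _ "c * d"]) simp
qed

text \<open>By the fundamental theorem of algebra, \<open>p(A)\<close> is a product of factors \<open>A - z\<close>
  over the roots \<open>z\<close> of \<open>p\<close>.\<close>
lemma bounded_below_cpoly_apply:
  fixes A :: "'a::complex_hilbert \<Rightarrow>\<^sub>L 'a"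
  assumes A: "complex_linear_op A"
    and "p \<noteq> 0"
    and "\<And>z. poly p z = 0 \<Longrightarrow> bounded_below (\<lambda>x. blinfun_apply A x - z *\<^sub>C x)"
  shows "bounded_below (cpoly_apply A p)"
  using assms(2,3)
proof (induction "degree p" arbitrary: p)
  case 0
  then obtain a where "p = [:a:]" "a \<noteq> 0" by (metis degree_eq_zeroE pCons_0_0)
  then show ?case unfolding bounded_below_def
    by (intro exI[of _ "cmod a"]) (simp add: norm_scaleC blinfun.bilinear_simps)
next
  case (Suc n)
  have "\<not> constant (poly p)" using Suc.hyps(2) by (simp add: constant_degree)
  then obtain z where z: "poly p z = 0" using fundamental_theorem_of_algebra by blast
  then obtain q where q: "p = [:-z, 1:] * q" by (auto simp: poly_eq_0_iff_dvd dvd_def)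
  then have "q \<noteq> 0" using Suc.prems(1) by auto
  then have "degree q = n" using Suc.hyps(2) unfolding q by (subst (asm) degree_mult_eq) auto
  then have "bounded_below (cpoly_apply A q)"
    using Suc.hyps(1)[of q] \<open>q \<noteq> 0\<close> Suc.prems(2) by (simp add: q)
  from bounded_below_comp[OF Suc.prems(2)[OF z] this]
  have "bounded_below (\<lambda>x. blinfun_apply A (cpoly_apply A q x) - z *\<^sub>C cpoly_apply A q x)" .
  moreover have "cpoly_apply A p =
      (\<lambda>x. blinfun_apply A (cpoly_apply A q x) - z *\<^sub>C cpoly_apply A q x)"
    unfolding q cpoly_apply_mult[OF A]
    by (simp add: fun_eq_iff blinfun.bilinear_simps scaleC_one)
  ultimately show ?case by simp
qed

text \<open>Cauchy-Schwarz bounds the right-hand side by \<open>norm (f x) * norm x\<close>, and one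
  factor \<open>norm x\<close> cancels.\<close>

lemma bounded_belowI_cinner:
  fixes f :: "'a::complex_hilbert \<Rightarrow> 'a"
  assumes "c > 0" "\<And>x. c * (norm x)\<^sup>2 \<le> cmod (cinner (f x) x)"
  shows "bounded_below f"
proof -
  have "c * norm x \<le> norm (f x)" for x
  proof (cases "x = 0")
    case False
    have "c * norm x * norm x \<le> norm (f x) * norm x"
      using order_trans[OF assms(2)[of x] cmod_cinner_le[of "f x" x]]
      by (simp add: power2_eq_square mult.assoc)
    then show ?thesis using False by simp
  qed auto
  then show ?thesis using assms(1) unfolding bounded_below_def by blast
qed

text \<open>On unit vectors the quadratic form of \<open>A\<close> takes values in
  \<open>{0..norm A}\<close>. A point \<open>z\<close> off this interval is nonreal, left of it or
  right of it, and the distance in that direction is the lower bound.\<close>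

lemma positive_op_spectrum:
  assumes A: "positive_op A" and z: "z \<notin> complex_of_real ` {0..norm A}"
  shows "bounded_below (\<lambda>x. blinfun_apply A x - z *\<^sub>C x)"
proof -
  have Im: "Im (cinner (blinfun_apply A x) x) = 0" for x
    using positive_op_cinner[OF A, of x x] cinner_commute[of x "blinfun_apply A x"]
    by (metis cnj.simps(2) neg_equal_zero)
  have Re: "0 \<le> Re (cinner (blinfun_apply A x) x)"
    "Re (cinner (blinfun_apply A x) x) \<le> norm A * (norm x)\<^sup>2" for x
    using positive_op_ge_0[OF A] Re_cinner_le[of "blinfun_apply A x" x]
      mult_right_mono[OF norm_blinfun[of A x], of "norm x"]
    by (auto simp: power2_eq_square mult.assoc)
  have eq: "cinner (blinfun_apply A x - z *\<^sub>C x) x =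
      cinner (blinfun_apply A x) x - z * complex_of_real ((norm x)\<^sup>2)" for x
    by (simp add: cinner_simps cinner_self)
  consider "Im z \<noteq> 0" | "Re z < 0" | "Re z > norm A"
  proof -
    have "z = complex_of_real (Re z)" if "Im z = 0" using that by (simp add: complex_eq_iff)
    then show ?thesis using z that by (metis atLeastAtMost_iff image_eqI not_le)
  qed
  then show ?thesis
  proof cases
    case 1
    have "\<bar>Im z\<bar> * (norm x)\<^sup>2 \<le> cmod (cinner (blinfun_apply A x - z *\<^sub>C x) x)" for x
      using abs_Im_le_cmod[of "cinner (blinfun_apply A x - z *\<^sub>C x) x"]
      unfolding eq by (simp add: Im abs_mult)
    then show ?thesis using 1 by (intro bounded_belowI_cinner) auto
  next
    case 2
    have "- Re z * (norm x)\<^sup>2 \<le> cmod (cinner (blinfun_apply A x - z *\<^sub>C x) x)" for x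
      using complex_Re_le_cmod[of "cinner (blinfun_apply A x - z *\<^sub>C x) x"] Re(1)[of x]
      unfolding eq by simp
    then show ?thesis using 2 by (intro bounded_belowI_cinner[of "- Re z"]) auto
  next
    case 3
    have "(Re z - norm A) * (norm x)\<^sup>2 \<le> cmod (cinner (blinfun_apply A x - z *\<^sub>C x) x)" for x
      using abs_Re_le_cmod[of "cinner (blinfun_apply A x - z *\<^sub>C x) x"] Re(2)[of x]
      unfolding eq by (simp add: algebra_simps)
    then show ?thesis using 3 by (intro bounded_belowI_cinner) auto
  qed
qed

section \<open>Algebra of real polynomials in an operator\<close>

lemma op_poly_0 [simp]: "op_poly 0 A = 0"
  by (simp add: op_poly_def)

lemma op_poly_pCons:
  "op_poly (pCons a p) A = a *\<^sub>R id_blinfun + (A o\<^sub>L op_poly p A)"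
proof (cases "p = 0")
  case False
  then show ?thesis
    by (simp add: op_poly_def sum.atMost_Suc_shift bounded_bilinear.sum_right[OF
          bounded_bilinear_blinfun_compose] bounded_bilinear.scaleR_right[OF
          bounded_bilinear_blinfun_compose] del: sum.atMost_Suc)
qed (cases "a = 0"; simp add: op_poly_def bounded_bilinear.zero_right[OF
      bounded_bilinear_blinfun_compose])

lemma op_poly_apply_pCons [simp]:
  "blinfun_apply (op_poly (pCons a p) A) x = a *\<^sub>R x + blinfun_apply A (blinfun_apply (op_poly p A) x)"
  by (simp add: op_poly_pCons blinfun.bilinear_simps)

lemma op_poly_add: "op_poly (p + q) A = op_poly p A + op_poly q A"
  by (induction p q rule: poly_induct2)
    (simp_all add: op_poly_pCons scaleR_add_left bounded_bilinear.add_right[OF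
      bounded_bilinear_blinfun_compose])

lemma op_poly_smult: "op_poly (smult c p) A = c *\<^sub>R op_poly p A"
  by (induction p) (simp_all add: op_poly_pCons scaleR_add_right bounded_bilinear.scaleR_right[OF
      bounded_bilinear_blinfun_compose])

lemma op_poly_diff: "op_poly (p - q) A = op_poly p A - op_poly q A"
  using op_poly_add[of p "smult (-1) q" A] unfolding op_poly_smult by simp

lemma op_poly_mult: "op_poly (p * q) A = op_poly p A o\<^sub>L op_poly q A"
  by (induction p) (auto intro!: blinfun_eqI simp: op_poly_add op_poly_smult blinfun.bilinear_simps)

lemma op_poly_const: "op_poly [:c:] A = c *\<^sub>R id_blinfun"
  by (auto intro!: blinfun_eqI simp: blinfun.bilinear_simps)

lemma op_poly_X: "op_poly [:0, 1:] A = A"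
  by (auto intro!: blinfun_eqI simp: blinfun.bilinear_simps)

lemma op_poly_apply_commute:
  "blinfun_apply (op_poly p A) (blinfun_apply A x) = blinfun_apply A (blinfun_apply (op_poly p A) x)"
  using op_poly_mult[of p "[:0, 1:]" A] op_poly_mult[of "[:0, 1:]" p A]
  by (metis blinfun_apply_blinfun_compose mult.commute op_poly_X)

lemma cpoly_apply_of_real:
  "cpoly_apply A (map_poly complex_of_real p) x = blinfun_apply (op_poly p A) x"
  by (induction p) (simp_all add: map_poly_pCons scaleC_of_real)

lemma cinner_op_poly:
  assumes "positive_op A"
  shows "cinner (blinfun_apply (op_poly p A) x) y = cinner x (blinfun_apply (op_poly p A) y)"
  by (induction p arbitrary: x y)
    (simp_all add: cinner_simps positive_op_cinner[OF assms] op_poly_apply_commute)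

lemma complex_linear_op_poly:
  assumes "complex_linear_op A"
  shows "complex_linear_op (op_poly p A)"
  using assms unfolding complex_linear_op_def
  by (induction p) (simp_all add: scaleC_add_right scaleC_of_real[symmetric] scaleC_scaleC mult.commute)

section \<open>Bounds on a polynomial in an operator from its values on the interval\<close>

lemma poly_map_poly_of_real:
  "poly (map_poly complex_of_real p) (complex_of_real t) = complex_of_real (poly p t)"
  by (induction p) (simp_all add: map_poly_pCons)

text \<open>Every complex root of \<open>p\<close> lies off the interval, so all linear factors of
  \<open>op_poly p A\<close> are bounded below.\<close>

lemma bounded_below_op_poly:
  assumes A: "positive_op A" and p: "\<And>t. t \<in> {0..norm A} \<Longrightarrow> poly p t \<noteq> 0"
  shows "bounded_below (blinfun_apply (op_poly p A))"
proof -
  have "p \<noteq> 0" using p[of 0] by auto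
  then have "bounded_below (cpoly_apply A (map_poly complex_of_real p))"
    using A p
    by (intro bounded_below_cpoly_apply positive_op_spectrum)
      (auto simp: map_poly_eq_0_iff poly_map_poly_of_real positive_op_complex_linear)
  moreover have "cpoly_apply A (map_poly complex_of_real p) = blinfun_apply (op_poly p A)"
    by (simp add: fun_eq_iff cpoly_apply_of_real)
  ultimately show ?thesis by simp
qed

text \<open>A selfadjoint \<open>T\<close> of norm \<open>N\<close> never has \<open>N\<^sup>2 - T\<^sup>2\<close> bounded below.\<close>
lemma norm_op_poly_le:
  assumes A: "positive_op A" and K: "\<And>t. t \<in> {0..norm A} \<Longrightarrow> \<bar>poly p t\<bar> \<le> K"
  shows "norm (op_poly p A) \<le> K"
proof (rule ccontr)
  define T where "T = op_poly p A"
  define N where "N = norm T"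
  assume "\<not> norm (op_poly p A) \<le> K"
  then have "K < N" by (simp add: T_def N_def)
  have "0 \<le> K" using K[of 0] by simp
  with \<open>K < N\<close> have N: "0 < N" by simp
  have "poly ([:N\<^sup>2:] - p * p) t \<noteq> 0" if "t \<in> {0..norm A}" for t
  proof -
    have "\<bar>poly p t\<bar> < \<bar>N\<bar>" using K[OF that] \<open>K < N\<close> N by simp
    then have "(poly p t)\<^sup>2 < N\<^sup>2" by (rule power2_strict_mono)
    then show ?thesis by (simp add: power2_eq_square)
  qed
  then obtain c where c: "c > 0"
    "\<And>x. c * norm x \<le> norm (blinfun_apply (op_poly ([:N\<^sup>2:] - p * p) A) x)"
    using bounded_below_op_poly[OF A] unfolding bounded_below_def by blast
  have TT: "blinfun_apply (op_poly ([:N\<^sup>2:] - p * p) A) x = N\<^sup>2 *\<^sub>R x - blinfun_apply T (blinfun_apply T x)" for x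
    by (simp add: op_poly_diff op_poly_mult op_poly_const blinfun.bilinear_simps T_def)
  \<comment> \<open>Expand the square of the norm of \<open>N\<^sup>2 *\<^sub>R x - T (T x)\<close>.
    By symmetry of \<open>T\<close> the cross term is twice \<open>N\<^sup>2\<close> times the
    squared norm of \<open>T x\<close>, and half of it absorbs the last square.\<close>
  have N4: "c\<^sup>2 * (norm x)\<^sup>2 \<le> N\<^sup>2 * (N\<^sup>2 * (norm x)\<^sup>2 - (norm (blinfun_apply T x))\<^sup>2)" for x
  proof -
    let ?y = "blinfun_apply T x"
    have "c\<^sup>2 * (norm x)\<^sup>2 \<le> (norm (N\<^sup>2 *\<^sub>R x - blinfun_apply T ?y))\<^sup>2"
      using power_mono[OF c(2)[of x], of 2] c(1) unfolding TT by (simp add: power_mult_distrib)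
    also have "\<dots> = N\<^sup>2 * N\<^sup>2 * (norm x)\<^sup>2 - 2 * N\<^sup>2 * (norm ?y)\<^sup>2 + (norm (blinfun_apply T ?y))\<^sup>2"
      using cinner_op_poly[OF A, of p x ?y]
      by (simp add: norm_diff_squared cinner_simps T_def[symmetric] Re_cinner_self power_mult_distrib
          power2_eq_square[of "N\<^sup>2"])
        (metis Re_cinner_self)
    also have "(norm (blinfun_apply T ?y))\<^sup>2 \<le> N\<^sup>2 * (norm ?y)\<^sup>2"
      using power_mono[OF norm_blinfun[of T ?y], of 2] by (simp add: power_mult_distrib N_def)
    finally show ?thesis by (simp add: algebra_simps)
  qed
  \<comment> \<open>This is \<open>N4\<close> solved for the norm of \<open>T x\<close>. The maximum
    with 0 keeps \<open>M\<close> nonnegative, since \<open>sqrt\<close> is negative at negative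
    arguments.\<close>
  define M where "M = sqrt (max 0 (N\<^sup>2 - c\<^sup>2 / N\<^sup>2))"
  have M0: "0 \<le> M" by (simp add: M_def)
  have "norm T \<le> M"
  proof (rule norm_blinfun_bound)
    fix x
    have "(norm (blinfun_apply T x))\<^sup>2 \<le> (N\<^sup>2 - c\<^sup>2 / N\<^sup>2) * (norm x)\<^sup>2"
      using N4[of x] N by (simp add: field_simps)
    also have "\<dots> \<le> M\<^sup>2 * (norm x)\<^sup>2" unfolding M_def by (intro mult_right_mono) auto
    finally show "norm (blinfun_apply T x) \<le> M * norm x"
      by (rule power2_le_imp_le[OF ord_le_eq_trans]) (simp_all add: power_mult_distrib M0)
  qed (rule M0)
  moreover have "M < N" unfolding M_def using N c(1) by (intro real_less_lsqrt) auto
  ultimately show False by (simp add: N_def)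
qed

text \<open>If \<open>p\<close> takes values between 0 and \<open>c\<close> on the interval, so does
  \<open>c - p\<close>. Hence \<open>c - p(A)\<close> has norm at most \<open>c\<close>, and its
  quadratic form is at most \<open>c\<close> times the squared norm.\<close>

lemma Re_cinner_op_poly_ge_0:
  assumes A: "positive_op A" and p: "\<And>t. t \<in> {0..norm A} \<Longrightarrow> 0 \<le> poly p t"
  shows "0 \<le> Re (cinner (blinfun_apply (op_poly p A) x) x)"
proof -
  have "compact (poly p ` {0..norm A})"
    by (intro compact_continuous_image continuous_intros) auto
  then obtain c where c: "\<And>t. t \<in> {0..norm A} \<Longrightarrow> \<bar>poly p t\<bar> \<le> c"
    using compact_imp_bounded bounded_iff[of "poly p ` {0..norm A}"] by (metis imageI real_norm_def)
  have "norm (op_poly ([:c:] - p) A) \<le> c"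
  proof (rule norm_op_poly_le[OF A])
    fix t assume "t \<in> {0..norm A}"
    then show "\<bar>poly ([:c:] - p) t\<bar> \<le> c" using p[of t] c[of t] by simp
  qed
  then have "Re (cinner (blinfun_apply (op_poly ([:c:] - p) A) x) x) \<le> c * norm x * norm x"
    using Re_cinner_le[of "blinfun_apply (op_poly ([:c:] - p) A) x" x]
      norm_blinfun[of "op_poly ([:c:] - p) A" x] mult_right_mono[of _ _ "norm x"]
    by (meson norm_ge_zero order_trans)
  then show ?thesis
    by (simp add: op_poly_diff op_poly_const blinfun.bilinear_simps cinner_simps Re_cinner_self
        power2_eq_square mult.assoc)
qed

text \<open>If \<open>A v\<close> stayed at distance \<open>e\<close> from
  \<open>norm A *\<^sub>R v\<close> for all unit \<open>v\<close>, the squared norm of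
  \<open>A\<close> would drop by \<open>e\<^sup>2\<close>. The vector \<open>u\<close> excludes the
  zero space.\<close>

lemma positive_op_approx_eigenvector:
  fixes A :: "'a::complex_hilbert \<Rightarrow>\<^sub>L 'a"
  assumes A: "positive_op A" and u: "norm (u :: 'a) = 1" and e: "0 < e"
  shows "\<exists>x. norm x = 1 \<and> norm (blinfun_apply A x - norm A *\<^sub>R x) < e"
proof (rule ccontr)
  assume "\<not> ?thesis"
  then have far: "e \<le> norm (blinfun_apply A x - norm A *\<^sub>R x)" if "norm x = 1" for x
    using that not_less by blast
  define M where "M = norm A"
  have le: "(norm (blinfun_apply A x))\<^sup>2 \<le> (M\<^sup>2 - e\<^sup>2) * (norm x)\<^sup>2" for x
  proof (cases "x = 0")
    case False
    define v where "v = inverse (norm x) *\<^sub>R x"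
    have v: "norm v = 1" "x = norm x *\<^sub>R v" using False by (auto simp: v_def)
    define b where "b = Re (cinner (blinfun_apply A v) v)"
    have eq: "(norm (blinfun_apply A v - M *\<^sub>R v))\<^sup>2 = (norm (blinfun_apply A v))\<^sup>2 - 2 * M * b + M\<^sup>2"
      using v(1) by (simp add: norm_diff_squared cinner_simps b_def)
    \<comment> \<open>The polynomial is \<open>t * (M - t)\<close>, nonnegative on
      \<open>{0..M}\<close>. Inserted into \<open>eq\<close>, the inequality removes
      \<open>b\<close>.\<close>
    have Cauchy: "(norm (blinfun_apply A v))\<^sup>2 \<le> M * b"
      using Re_cinner_op_poly_ge_0[OF A, of "[:0, M, -1:]" v]
        positive_op_cinner[OF A, of "blinfun_apply A v" v]
      by (simp add: M_def b_def blinfun.bilinear_simps cinner_simps Re_cinner_self)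
    have "e\<^sup>2 \<le> (norm (blinfun_apply A v - M *\<^sub>R v))\<^sup>2"
      using far[OF v(1)] e by (intro power_mono) (auto simp: M_def)
    then have "(norm (blinfun_apply A v))\<^sup>2 \<le> M\<^sup>2 - e\<^sup>2" using eq Cauchy by linarith
    then have "(norm x)\<^sup>2 * (norm (blinfun_apply A v))\<^sup>2 \<le> (norm x)\<^sup>2 * (M\<^sup>2 - e\<^sup>2)"
      by (rule mult_left_mono) simp
    moreover have "norm (blinfun_apply A x) = norm x * norm (blinfun_apply A v)"
      using v(2) by (metis blinfun.scaleR_right norm_scaleR abs_norm_cancel)
    ultimately show ?thesis by (simp add: power_mult_distrib mult.commute)
  qed (simp add: blinfun.bilinear_simps)
  have pos: "0 \<le> M\<^sup>2 - e\<^sup>2" using order_trans[OF zero_le_power2 le[of u]] u by simp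
  have "norm A \<le> sqrt (M\<^sup>2 - e\<^sup>2)"
  proof (rule norm_blinfun_bound)
    show "norm (blinfun_apply A x) \<le> sqrt (M\<^sup>2 - e\<^sup>2) * norm x" for x
      using real_le_rsqrt[OF le[of x]] by (simp add: real_sqrt_mult)
  qed (simp only: pos real_sqrt_ge_0_iff)
  then have "M\<^sup>2 \<le> M\<^sup>2 - e\<^sup>2"
    using power_mono[of "norm A" "sqrt (M\<^sup>2 - e\<^sup>2)" 2] pos by (simp add: M_def)
  then show False using e by simp
qed

text \<open>Write \<open>p\<close> as \<open>p (norm A)\<close> plus a multiple \<open>q\<close> of
  the factor \<open>t - norm A\<close>. On an approximate eigenvector for \<open>norm A\<close> the
  second summand is negligible.\<close>

lemma abs_poly_norm_le:
  fixes A :: "'a::complex_hilbert \<Rightarrow>\<^sub>L 'a"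
  assumes A: "positive_op A" and u: "norm (u :: 'a) = 1"
  shows "\<bar>poly p (norm A)\<bar> \<le> norm (op_poly p A)"
proof (rule field_le_epsilon)
  fix d :: real assume d: "0 < d"
  have "[:- norm A, 1:] dvd p - [:poly p (norm A):]"
    by (simp add: poly_eq_0_iff_dvd[symmetric])
  then obtain q where "p - [:poly p (norm A):] = [:- norm A, 1:] * q" by (elim dvdE)
  then have p: "p = [:poly p (norm A):] + q * [:- norm A, 1:]"
    by (simp add: algebra_simps)
  \<comment> \<open>The error term is at most \<open>norm (op_poly q A) * e\<close>, hence at most
    \<open>d\<close>; the added 1 avoids division by zero.\<close>
  define e where "e = d / (norm (op_poly q A) + 1)"
  have e: "0 < e" using d by (simp add: e_def add_nonneg_pos)
  obtain x where x: "norm x = 1" "norm (blinfun_apply A x - norm A *\<^sub>R x) < e"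
    using positive_op_approx_eigenvector[OF A u e] by blast
  have "blinfun_apply (op_poly p A) x =
      poly p (norm A) *\<^sub>R x + blinfun_apply (op_poly q A) (blinfun_apply A x - norm A *\<^sub>R x)"
    by (subst p, unfold op_poly_add op_poly_mult op_poly_const)
      (simp add: blinfun.bilinear_simps)
  then have "poly p (norm A) *\<^sub>R x = blinfun_apply (op_poly p A) x
      - blinfun_apply (op_poly q A) (blinfun_apply A x - norm A *\<^sub>R x)" by simp
  then have "norm (poly p (norm A) *\<^sub>R x) \<le> norm (blinfun_apply (op_poly p A) x)
      + norm (blinfun_apply (op_poly q A) (blinfun_apply A x - norm A *\<^sub>R x))"
    by (metis norm_triangle_ineq4)
  also have "\<dots> \<le> norm (op_poly p A) + norm (op_poly q A) * e"
    using norm_blinfun[of "op_poly p A" x] x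
      order_trans[OF norm_blinfun[of "op_poly q A" "blinfun_apply A x - norm A *\<^sub>R x"]
        mult_left_mono[OF less_imp_le[OF x(2)]]]
    by (intro add_mono) auto
  also have "norm (op_poly q A) * e \<le> (norm (op_poly q A) + 1) * e"
    using e by (intro mult_right_mono) auto
  also have "\<dots> = d"
    by (simp add: e_def) (metis add_nonneg_pos less_irrefl norm_ge_zero zero_less_one)
  finally show "\<bar>poly p (norm A)\<bar> \<le> norm (op_poly p A) + d" using x by simp
qed

section \<open>Powers of a positive operator\<close>

lemma Weierstrass_uniform_limit:
  fixes f :: "real \<Rightarrow> real"
  assumes "continuous_on {a..b} f"
  shows "\<exists>p. uniform_limit {a..b} (\<lambda>n. poly (p n)) f sequentially"
proof -
  have "\<exists>p. \<forall>x\<in>{a..b}. \<bar>f x - poly p x\<bar> < inverse (real (Suc n))" for n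
  proof -
    obtain g where g: "real_polynomial_function g"
      "\<And>x. x \<in> {a..b} \<Longrightarrow> \<bar>f x - g x\<bar> < inverse (real (Suc n))"
      using Stone_Weierstrass_real_polynomial_function[OF compact_Icc assms, of "inverse (real (Suc n))"]
      by auto
    from real_polynomial_function_imp_sum[OF g(1)]
    obtain c m where c: "g = (\<lambda>x. \<Sum>i\<le>(m::nat). c i * x ^ i)" by blast
    have "poly (\<Sum>i\<le>m. monom (c i) i) x = g x" for x by (simp add: c poly_sum poly_monom)
    then show ?thesis using g(2) by (intro exI[of _ "\<Sum>i\<le>m. monom (c i) i"]) simp
  qed
  then obtain p where p: "\<And>n x. x \<in> {a..b} \<Longrightarrow> \<bar>f x - poly (p n) x\<bar> < inverse (real (Suc n))"
    by metis
  have "uniform_limit {a..b} (\<lambda>n. poly (p n)) f sequentially"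
  proof (rule uniform_limitI)
    fix e :: real assume "0 < e"
    with order_tendstoD(2)[OF LIMSEQ_inverse_real_of_nat]
    have "\<forall>\<^sub>F n in sequentially. inverse (real (Suc n)) < e" .
    then show "\<forall>\<^sub>F n in sequentially. \<forall>x\<in>{a..b}. dist (poly (p n) x) (f x) < e"
    proof eventually_elim
      case (elim n)
      show ?case using p[of _ n] elim by (force simp: dist_real_def abs_minus_commute)
    qed
  qed
  then show ?thesis by blast
qed

text \<open>The differences \<open>p n - q n\<close> tend to 0 uniformly on the interval, hence in
  operator norm after inserting \<open>A\<close>. So the limit depends on \<open>f\<close> only,
  which makes the description in \<open>op_powr\<close> unique.\<close>

lemma op_poly_LIMSEQ_cong:
  assumes A: "positive_op A"
    and p: "uniform_limit {0..norm A} (\<lambda>n. poly (p n)) f sequentially"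
    and q: "uniform_limit {0..norm A} (\<lambda>n. poly (q n)) f sequentially"
    and B: "(\<lambda>n. op_poly (q n) A) \<longlonglongrightarrow> B"
  shows "(\<lambda>n. op_poly (p n) A) \<longlonglongrightarrow> B"
proof -
  have "(\<lambda>n. op_poly (p n - q n) A) \<longlonglongrightarrow> 0"
  proof (rule metric_LIMSEQ_I)
    fix e :: real assume e: "0 < e"
    have "uniform_limit {0..norm A} (\<lambda>n x. poly (p n) x - poly (q n) x) (\<lambda>x. f x - f x) sequentially"
      by (rule uniform_limit_minus[OF p q])
    from uniform_limitD[OF this half_gt_zero[OF e]]
    obtain N where "\<And>n t. n \<ge> N \<Longrightarrow> t \<in> {0..norm A} \<Longrightarrow> \<bar>poly (p n - q n) t\<bar> < e / 2"
      unfolding eventually_sequentially dist_real_def poly_diff diff_self diff_0_right by blast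
    then have bd: "norm (op_poly (p n - q n) A) \<le> e / 2" if "n \<ge> N" for n
      using that less_imp_le by (intro norm_op_poly_le[OF A]) blast
    have "dist (op_poly (p n - q n) A) 0 < e" if "n \<ge> N" for n
      using bd[OF that] e by simp
    then show "\<exists>N. \<forall>n\<ge>N. dist (op_poly (p n - q n) A) 0 < e" by blast
  qed
  from tendsto_add[OF this B] show ?thesis by (simp add: op_poly_diff)
qed

text \<open>Uniformly Cauchy polynomials give a Cauchy sequence of operators by
  \<open>norm_op_poly_le\<close>, and the space of bounded operators is complete.\<close>

lemma op_poly_convergent:
  assumes A: "positive_op A"
    and p: "uniform_limit {0..norm A} (\<lambda>n. poly (p n)) f sequentially"
  shows "convergent (\<lambda>n. op_poly (p n) A)"
  unfolding Cauchy_convergent_iff[symmetric]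
proof (rule metric_CauchyI)
  fix e :: real assume e: "0 < e"
  have "0 < e / 4" using e by simp
  from uniform_limitD[OF p this]
  obtain N where N: "\<And>n t. n \<ge> N \<Longrightarrow> t \<in> {0..norm A} \<Longrightarrow> \<bar>poly (p n) t - f t\<bar> < e / 4"
    unfolding eventually_sequentially dist_real_def by blast
  have "dist (op_poly (p m) A) (op_poly (p n) A) < e" if "m \<ge> N" "n \<ge> N" for m n
  proof -
    have "norm (op_poly (p m - p n) A) \<le> e / 2"
    proof (rule norm_op_poly_le[OF A])
      fix t assume "t \<in> {0..norm A}"
      then show "\<bar>poly (p m - p n) t\<bar> \<le> e / 2"
        using N[OF that(1), of t] N[OF that(2), of t] unfolding poly_diff by linarith
    qed
    then show ?thesis using e by (simp add: dist_norm op_poly_diff)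
  qed
  then show "\<exists>M. \<forall>m\<ge>M. \<forall>n\<ge>M. dist (op_poly (p m) A) (op_poly (p n) A) < e" by blast
qed

section \<open>Nonnegative real powers of a positive operator\<close>

abbreviation powr0 :: "real \<Rightarrow> real \<Rightarrow> real" where
  "powr0 s \<equiv> (\<lambda>t. if s = 0 then 1 else t powr s)"

text \<open>Nonnegativity ensures that \<open>a + b\<close> is zero only if both exponents are. For
  exponents 1 and -1 the identity fails at \<open>t = 0\<close>.\<close>

lemma powr0_add:
  assumes "0 \<le> a" "0 \<le> b"
  shows "powr0 (a + b) t = powr0 a t * powr0 b t"
  using assms by (auto simp: powr_add add_nonneg_eq_0_iff)

lemma continuous_on_powr0:
  assumes "0 \<le> s"
  shows "continuous_on {0..M} (powr0 s)"
proof (cases "s = 0")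
  case False
  then have "continuous_on {0..M} (\<lambda>t. t powr s)"
    using assms by (intro continuous_on_powr' continuous_intros) auto
  then show ?thesis using False by simp
qed auto

lemma powr0_approx:
  assumes "0 \<le> s"
  obtains p where "uniform_limit {0..M} (\<lambda>n. poly (p n)) (powr0 s) sequentially"
  using Weierstrass_uniform_limit[OF continuous_on_powr0[OF assms]] by blast

lemma op_powr_LIMSEQ:
  assumes A: "positive_op A" and s: "0 \<le> s"
    and p: "uniform_limit {0..norm A} (\<lambda>n. poly (p n)) (powr0 s) sequentially"
  shows "(\<lambda>n. op_poly (p n) A) \<longlonglongrightarrow> op_powr A s"
proof -
  obtain B where B: "(\<lambda>n. op_poly (p n) A) \<longlonglongrightarrow> B"
    using op_poly_convergent[OF A p] by (auto simp: convergent_def)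
  have "op_powr A s = B"
    unfolding op_powr_def
  proof (rule the_equality)
    show "\<forall>p. uniform_limit {0..norm A} (\<lambda>n. poly (p n)) (powr0 s) sequentially
        \<longrightarrow> (\<lambda>n. op_poly (p n) A) \<longlonglongrightarrow> B"
      using op_poly_LIMSEQ_cong[OF A _ p B] by blast
    fix B' assume "\<forall>p. uniform_limit {0..norm A} (\<lambda>n. poly (p n)) (powr0 s) sequentially
        \<longrightarrow> (\<lambda>n. op_poly (p n) A) \<longlonglongrightarrow> B'"
    then show "B' = B" using p B LIMSEQ_unique by blast
  qed
  then show ?thesis using B by simp
qed

lemma tendsto_cinner_op:
  assumes "F \<longlonglongrightarrow> B"
  shows "(\<lambda>n. Re (cinner (blinfun_apply (F n) x) y)) \<longlonglongrightarrow> Re (cinner (blinfun_apply B x) y)"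
  by (intro bounded_linear.tendsto[OF bounded_linear_Re_cinner] blinfun.tendsto assms tendsto_const)

text \<open>Transfers a polynomial minorant of the power to quadratic forms. It is used with the
  zero polynomial for positivity and with a tangent for Jensen's inequality. An approximant within
  \<open>e\<close> of the power satisfies \<open>p n - g + e \<ge> 0\<close> on the
  interval.\<close>

lemma Re_cinner_op_powr_ge:
  assumes A: "positive_op A" and s: "0 \<le> s"
    and g: "\<And>t. 0 \<le> t \<Longrightarrow> poly g t \<le> powr0 s t"
  shows "Re (cinner (blinfun_apply (op_poly g A) x) x) \<le> Re (cinner (blinfun_apply (op_powr A s) x) x)"
proof (rule field_le_epsilon)
  fix d :: real assume d: "0 < d"
  \<comment> \<open>Shifting by \<open>e\<close> changes the quadratic form by
    \<open>e * (norm x)\<^sup>2\<close>, which must not exceed \<open>d\<close>.\<close>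
  define e where "e = d / ((norm x)\<^sup>2 + 1)"
  have e: "0 < e" "e * (norm x)\<^sup>2 \<le> d"
    using d by (auto simp: e_def divide_simps add_nonneg_pos)
  obtain p where p: "uniform_limit {0..norm A} (\<lambda>n. poly (p n)) (powr0 s) sequentially"
    using powr0_approx[OF s] by blast
  from uniform_limitD[OF p e(1)]
  have ev: "\<forall>\<^sub>F n in sequentially. Re (cinner (blinfun_apply (op_poly g A) x) x)
      \<le> Re (cinner (blinfun_apply (op_poly (p n) A) x) x) + d"
  proof eventually_elim
    case (elim n)
    have "0 \<le> Re (cinner (blinfun_apply (op_poly (p n - g + [:e:]) A) x) x)"
    proof (rule Re_cinner_op_poly_ge_0[OF A])
      fix t assume t: "t \<in> {0..norm A}"
      then have "\<bar>poly (p n) t - powr0 s t\<bar> < e" using elim by (simp add: dist_real_def)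
      moreover have "poly g t \<le> powr0 s t" using g t by simp
      ultimately show "0 \<le> poly (p n - g + [:e:]) t" by simp
    qed
    then show ?case using e(2)
      by (simp add: op_poly_diff op_poly_add op_poly_const blinfun.bilinear_simps cinner_simps
          Re_cinner_self)
  qed
  show "Re (cinner (blinfun_apply (op_poly g A) x) x)
      \<le> Re (cinner (blinfun_apply (op_powr A s) x) x) + d"
    by (rule tendsto_le[OF trivial_limit_sequentially _ tendsto_const ev])
      (intro tendsto_add tendsto_const tendsto_cinner_op op_powr_LIMSEQ[OF A s p])
qed

text \<open>Complex linearity and symmetry pass from the approximating polynomials to the limit
  through real parts of inner products; for linearity the scalar is moved to the other
  argument.\<close>

lemma positive_op_powr:
  assumes A: "positive_op A" and s: "0 \<le> s"
  shows "positive_op (op_powr A s)"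
proof -
  obtain p where p: "uniform_limit {0..norm A} (\<lambda>n. poly (p n)) (powr0 s) sequentially"
    using powr0_approx[OF s] by blast
  note lim = op_powr_LIMSEQ[OF A s p]
  have lin: "complex_linear_op (op_powr A s)"
    unfolding complex_linear_op_def
  proof (intro allI cinner_ext_Re)
    fix c x y
    have eq: "Re (cinner (blinfun_apply (op_poly (p n) A) (c *\<^sub>C x)) y)
        = Re (cinner (blinfun_apply (op_poly (p n) A) x) (cnj c *\<^sub>C y))" for n
      using complex_linear_op_poly[OF positive_op_complex_linear[OF A]]
      by (simp add: complex_linear_op_def cinner_simps)
    have "Re (cinner (blinfun_apply (op_powr A s) (c *\<^sub>C x)) y)
        = Re (cinner (blinfun_apply (op_powr A s) x) (cnj c *\<^sub>C y))"
      using LIMSEQ_unique[OF tendsto_cinner_op[OF lim, of "c *\<^sub>C x" y, unfolded eq]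
        tendsto_cinner_op[OF lim]] .
    then show "Re (cinner y (blinfun_apply (op_powr A s) (c *\<^sub>C x)))
        = Re (cinner y (c *\<^sub>C blinfun_apply (op_powr A s) x))"
      by (subst (1 2) Re_cinner_commute) (simp add: cinner_simps)
  qed
  have "Re (cinner (blinfun_apply (op_powr A s) x) y) = Re (cinner x (blinfun_apply (op_powr A s) y))"
    for x y
  proof -
    have eq: "Re (cinner (blinfun_apply (op_poly (p n) A) x) y)
        = Re (cinner (blinfun_apply (op_poly (p n) A) y) x)" for n
      using cinner_op_poly[OF A] Re_cinner_commute by metis
    show ?thesis
      using LIMSEQ_unique[OF tendsto_cinner_op[OF lim, of x y, unfolded eq]
        tendsto_cinner_op[OF lim, of y x]] Re_cinner_commute by metis
  qed
  then have "cinner (blinfun_apply (op_powr A s) x) y = cinner x (blinfun_apply (op_powr A s) y)"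
    for x y
    using Re_cinner_complex_linear_eqI lin unfolding complex_linear_op_def by blast
  moreover have "0 \<le> Re (cinner (blinfun_apply (op_powr A s) x) x)" for x
    using Re_cinner_op_powr_ge[OF A s, of 0 x] by simp
  ultimately show ?thesis using lin by (simp add: positive_op_def)
qed

text \<open>The lower bound evaluates the approximating polynomials at \<open>norm A\<close>; the
  upper bound uses that the power is increasing in \<open>t\<close>. On the zero space the case
  \<open>s = 0\<close> would fail, hence the unit vector \<open>u\<close>.\<close>

lemma norm_op_powr:
  fixes A :: "'a::complex_hilbert \<Rightarrow>\<^sub>L 'a"
  assumes A: "positive_op A" and s: "0 \<le> s" and u: "norm (u :: 'a) = 1"
  shows "norm (op_powr A s) = powr0 s (norm A)"
proof -
  obtain p where p: "uniform_limit {0..norm A} (\<lambda>n. poly (p n)) (powr0 s) sequentially"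
    using powr0_approx[OF s] by blast
  have lim: "(\<lambda>n. norm (op_poly (p n) A)) \<longlonglongrightarrow> norm (op_powr A s)"
    by (intro tendsto_norm op_powr_LIMSEQ[OF A s p])
  have plim: "(\<lambda>n. poly (p n) (norm A)) \<longlonglongrightarrow> powr0 s (norm A)"
    using tendsto_uniform_limitI[OF p, of "norm A"] by simp
  have "\<bar>powr0 s (norm A)\<bar> \<le> norm (op_powr A s)"
    by (rule LIMSEQ_le[OF tendsto_rabs[OF plim] lim]) (use abs_poly_norm_le[OF A u] in blast)
  moreover have "norm (op_powr A s) \<le> powr0 s (norm A)"
  proof (rule field_le_epsilon)
    fix e :: real assume "0 < e"
    from uniform_limitD[OF p this]
    have "\<forall>\<^sub>F n in sequentially. norm (op_poly (p n) A) \<le> powr0 s (norm A) + e"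
    proof eventually_elim
      case (elim n)
      show ?case
      proof (rule norm_op_poly_le[OF A])
        fix t assume t: "t \<in> {0..norm A}"
        then have "\<bar>poly (p n) t - powr0 s t\<bar> < e" using elim by (simp add: dist_real_def)
        moreover have "0 \<le> powr0 s t" "powr0 s t \<le> powr0 s (norm A)"
          using t s by (auto intro: powr_mono2)
        ultimately show "\<bar>poly (p n) t\<bar> \<le> powr0 s (norm A) + e" by linarith
      qed
    qed
    then show "norm (op_powr A s) \<le> powr0 s (norm A) + e"
      by (intro tendsto_le[OF trivial_limit_sequentially tendsto_const lim])
  qed
  ultimately show ?thesis by linarith
qed

text \<open>The squares of polynomials approximating the square root converge uniformly to the
  identity function, as does the constant sequence \<open>[:0, 1:]\<close>, so both yield the same
  operator.\<close>

lemma op_powr_half_squared: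
  assumes A: "positive_op A"
  shows "op_powr A (1 / 2) o\<^sub>L op_powr A (1 / 2) = A"
proof -
  obtain p where p: "uniform_limit {0..norm A} (\<lambda>n. poly (p n)) (powr0 (1 / 2)) sequentially"
    by (rule powr0_approx[of "1 / 2"]) (simp, blast)
  have "bounded (powr0 (1 / 2) ` {0..norm A})"
    by (intro compact_imp_bounded compact_continuous_image continuous_on_powr0) auto
  from uniform_lim_mult[OF p p this this]
  have "uniform_limit {0..norm A} (\<lambda>n. poly (p n * p n)) (\<lambda>t. t) sequentially"
    by (rule uniform_limit_cong'[THEN iffD1, rotated 2])
      (auto simp: powr_half_sqrt)
  moreover have "uniform_limit {0..norm A} (\<lambda>n. poly [:0, 1:]) (\<lambda>t. t) sequentially"
    by (auto intro!: uniform_limitI)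
  ultimately have "(\<lambda>n. op_poly (p n * p n) A) \<longlonglongrightarrow> A"
    using op_poly_LIMSEQ_cong[OF A, of _ _ "\<lambda>n. [:0, 1:]" A] by (simp add: op_poly_X)
  moreover have "(\<lambda>n. op_poly (p n * p n) A) \<longlonglongrightarrow> (op_powr A (1 / 2) o\<^sub>L op_powr A (1 / 2))"
    unfolding op_poly_mult
    by (intro bounded_bilinear.tendsto[OF bounded_bilinear_blinfun_compose] op_powr_LIMSEQ[OF A _ p])
      auto
  ultimately show ?thesis using LIMSEQ_unique by blast
qed

section \<open>Operator Jensen inequality\<close>

text \<open>A convex function lies above its tangent at \<open>a\<close>. The convexity argument
  runs on the positive reals, so \<open>t = 0\<close> is computed directly.\<close>

lemma powr_ge_tangent:
  fixes a t r :: real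
  assumes a: "0 < a" and t: "0 \<le> t" and r: "1 \<le> r"
  shows "a powr r + r * a powr (r - 1) * (t - a) \<le> t powr r"
proof (cases "t = 0")
  case True
  have "a powr r = a powr (r - 1) * a" using a by (simp add: powr_diff)
  then have "a powr r + r * a powr (r - 1) * (t - a) = (1 - r) * a powr r"
    using True by (simp add: algebra_simps)
  also have "\<dots> \<le> 0" using r by (simp add: mult_nonpos_nonneg)
  finally show ?thesis by (meson order_trans powr_ge_zero)
next
  case False
  have "t powr r - a powr r \<ge> r * a powr (r - 1) * (t - a)"
    using a t r False
    by (intro convex_on_imp_above_tangent[OF powr_convex])
      (auto intro!: derivative_eq_intros simp: interior_open)
  then show ?thesis by linarith
qed

text \<open>With \<open>a\<close> the squared norm of \<open>Q x\<close>, the tangent to the power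
  \<open>r\<close> at \<open>a\<close>, taken at \<open>t\<^sup>2\<close>, is a polynomial below
  \<open>t powr (2 * r)\<close>. Its quadratic form at the unit vector \<open>x\<close> equals
  \<open>a powr r\<close>, because the form of \<open>Q\<close> squared at \<open>x\<close> is
  \<open>a\<close>.\<close>

lemma norm_powr_le_cinner_op_powr:
  assumes Q: "positive_op Q" and x: "norm x = 1" and r: "1 \<le> r"
  shows "norm (blinfun_apply Q x) powr (2 * r) \<le> Re (cinner (blinfun_apply (op_powr Q (2 * r)) x) x)"
proof (cases "blinfun_apply Q x = 0")
  case True
  then show ?thesis using positive_op_ge_0[OF positive_op_powr[OF Q]] r by simp
next
  case False
  define a where "a = (norm (blinfun_apply Q x))\<^sup>2"
  have a: "0 < a" using False by (simp add: a_def)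
  have ar: "norm (blinfun_apply Q x) powr (2 * r) = a powr r"
    using False by (simp add: a_def powr_powr[symmetric])
  let ?g = "[:a powr r - r * a powr (r - 1) * a, 0, r * a powr (r - 1):]"
  have "Re (cinner (blinfun_apply (op_poly ?g Q) x) x) \<le> Re (cinner (blinfun_apply (op_powr Q (2 * r)) x) x)"
  proof (rule Re_cinner_op_powr_ge[OF Q])
    fix t :: real assume t: "0 \<le> t"
    have "t powr (2 * r) = (t\<^sup>2) powr r"
      using t by (cases "t = 0") (auto simp: powr_powr[symmetric])
    then show "poly ?g t \<le> powr0 (2 * r) t"
      using powr_ge_tangent[OF a, of "t\<^sup>2" r] r by (simp add: power2_eq_square algebra_simps)
  qed (use r in simp)
  moreover have "Re (cinner (blinfun_apply Q (blinfun_apply Q x)) x) = a"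
    by (simp add: positive_op_cinner[OF Q, of "blinfun_apply Q x" x] Re_cinner_self a_def)
  ultimately show ?thesis
    unfolding ar using x by (simp add: blinfun.bilinear_simps cinner_simps Re_cinner_self)
qed

section \<open>The absolute value\<close>

lemma positive_op_cadjoint_compose:
  assumes T: "complex_linear_op T"
  shows "positive_op (cadjoint T o\<^sub>L T)"
  using T complex_linear_op_cadjoint[OF T] unfolding positive_op_def
  by (simp add: cinner_cadjoint'[OF T] cinner_cadjoint[OF T, symmetric] Re_cinner_self)
    (simp add: complex_linear_op_def)

lemma positive_op_abs: "complex_linear_op T \<Longrightarrow> positive_op (op_abs T)"
  unfolding op_abs_def by (intro positive_op_powr positive_op_cadjoint_compose) simp_all

text \<open>The square of \<open>op_abs T\<close> is \<open>cadjoint T\<close> composed with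
  \<open>T\<close>, so both squared norms are the same quadratic form.\<close>

lemma norm_op_abs_apply:
  assumes T: "complex_linear_op T"
  shows "norm (blinfun_apply (op_abs T) x) = norm (blinfun_apply T x)"
proof -
  have "(norm (blinfun_apply (op_abs T) x))\<^sup>2 = Re (cinner (blinfun_apply (op_abs T o\<^sub>L op_abs T) x) x)"
    by (simp add: positive_op_cinner[OF positive_op_abs[OF T], of "blinfun_apply (op_abs T) x" x]
        Re_cinner_self)
  also have "\<dots> = (norm (blinfun_apply T x))\<^sup>2"
    unfolding op_abs_def op_powr_half_squared[OF positive_op_cadjoint_compose[OF T]]
    by (simp add: cinner_cadjoint'[OF T] Re_cinner_self)
  finally show ?thesis by (simp add: power2_eq_iff_nonneg)
qed

lemma norm_op_abs: "complex_linear_op T \<Longrightarrow> norm (op_abs T) = norm T"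
  by (simp add: norm_blinfun.rep_eq onorm_def norm_op_abs_apply)

lemma norm_powr_le_cinner_op_abs:
  assumes "complex_linear_op T" "norm x = 1" "1 \<le> r"
  shows "norm (blinfun_apply T x) powr (2 * r)
      \<le> Re (cinner (blinfun_apply (op_powr (op_abs T) (2 * r)) x) x)"
  using norm_powr_le_cinner_op_powr[OF positive_op_abs[OF assms(1)] assms(2,3)]
  by (simp add: norm_op_abs_apply[OF assms(1)])

section \<open>The q-numerical radius\<close>

text \<open>Gram-Schmidt turns two independent vectors into an orthonormal pair \<open>u\<close>,
  \<open>w\<close>; then \<open>y\<close> is \<open>u\<close> rotated towards \<open>w\<close>. This
  makes the set under the supremum nonempty and supplies a unit vector for the norm
  formulas.\<close>

lemma q_numerical_pair_exists:
  assumes dim: "\<exists>X :: 'a::complex_hilbert set. complex_vector.independent X \<and> card X = 2"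
    and q: "0 \<le> q" "q \<le> 1"
  shows "\<exists>x y :: 'a. norm x = 1 \<and> norm y = 1 \<and> cinner x y = complex_of_real q"
proof -
  obtain a b :: 'a where ab: "a \<noteq> b" "complex_vector.independent {a, b}"
    using dim by (auto simp: card_2_iff)
  have a: "a \<noteq> 0" using ab(2) complex_vector.dependent_zero by auto
  define u where "u = inverse (norm a) *\<^sub>R a"
  have u: "norm u = 1" using a by (simp add: u_def)
  define v where "v = b - cinner b u *\<^sub>C u"
  have vu: "cinner v u = 0" using u by (simp add: v_def cinner_simps cinner_self)
  have "v \<noteq> 0"
  proof
    assume "v = 0"
    then have "b = (cinner b u * complex_of_real (inverse (norm a))) *\<^sub>C a"
      by (simp add: v_def u_def scaleC_of_real[symmetric] scaleC_scaleC)
    then have "b \<in> complex_vector.span {a}"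
      by (metis complex_vector.span_base complex_vector.span_scale singletonI)
    then show False
      using ab complex_vector.independent_insert[of b "{a}"] by (auto simp: insert_commute)
  qed
  define w where "w = inverse (norm v) *\<^sub>R v"
  have w: "norm w = 1" "cinner u w = 0"
    using \<open>v \<noteq> 0\<close> vu cinner_commute[of u v] by (simp_all add: w_def cinner_simps)
  define y where "y = q *\<^sub>R u + sqrt (1 - q\<^sup>2) *\<^sub>R w"
  have "q\<^sup>2 \<le> 1" using q by (simp add: power_le_one)
  then have "(norm y)\<^sup>2 = 1" by (simp add: y_def norm_add_squared cinner_simps u w power_mult_distrib)
  then have "norm y = 1" using norm_ge_zero[of y] by (simp add: power2_eq_1_iff)
  moreover have "cinner u y = complex_of_real q"
    by (simp add: y_def cinner_simps cinner_self u w scaleR_conv_of_real)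
  ultimately show ?thesis using u by blast
qed

text \<open>In the expansion along \<open>x\<close> and \<open>z\<close>, only the diagonal term in
  \<open>x\<close> is kept exactly. The diagonal term in \<open>z\<close> and both mixed terms are
  bounded by \<open>norm B\<close>.\<close>

lemma Re_cinner_q_pair_le:
  fixes B :: "'a::complex_hilbert \<Rightarrow>\<^sub>L 'a"
  assumes x: "norm x = 1" and y: "norm y = 1" and xy: "cinner x y = complex_of_real q"
    and q: "0 < q" "q < 1"
  shows "Re (cinner (blinfun_apply B y) y) \<le> q\<^sup>2 * Re (cinner (blinfun_apply B x) x)
    + (1 - q\<^sup>2) * norm B + 2 * q * sqrt (1 - q\<^sup>2) * norm B"
proof -
  define s where "s = sqrt (1 - q\<^sup>2)"
  have "q\<^sup>2 < 1" using q by (simp add: power_less_one_iff)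
  then have s: "0 < s" "s\<^sup>2 = 1 - q\<^sup>2" by (simp_all add: s_def)
  define z where "z = inverse s *\<^sub>R (y - q *\<^sub>R x)"
  have yz: "y = q *\<^sub>R x + s *\<^sub>R z" using s by (simp add: z_def)
  have "(norm (y - q *\<^sub>R x))\<^sup>2 = s\<^sup>2"
    using Re_cinner_commute[of y x]
    by (simp add: norm_diff_squared x y cinner_simps xy s power_mult_distrib)
      (simp add: power2_eq_square)
  then have "norm (y - q *\<^sub>R x) = s" using s(1) by (auto intro: power2_eq_imp_eq)
  then have z: "norm z = 1" using s(1) by (simp add: z_def)
  have "Re (cinner (blinfun_apply B y) y) = q\<^sup>2 * Re (cinner (blinfun_apply B x) x)
      + s\<^sup>2 * Re (cinner (blinfun_apply B z) z)
      + q * s * (Re (cinner (blinfun_apply B x) z) + Re (cinner (blinfun_apply B z) x))"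
    unfolding yz by (simp add: blinfun.bilinear_simps cinner_simps power2_eq_square algebra_simps)
  also have "\<dots> \<le> q\<^sup>2 * Re (cinner (blinfun_apply B x) x) + s\<^sup>2 * norm B
      + q * s * (norm B + norm B)"
    using s q x z \<open>q\<^sup>2 < 1\<close> by (intro add_mono mult_left_mono Re_cinner_blinfun_le order_refl) auto
  finally show ?thesis by (simp add: s(2) s_def[symmetric] algebra_simps)
qed

theorem theorem2p1:
  fixes S :: "'a::complex_hilbert \<Rightarrow>\<^sub>L 'a" and q \<alpha> r :: real
  assumes dim: "\<exists>X :: 'a set. complex_vector.independent X \<and> card X = 2"
    and S: "complex_linear_op S"
    and q: "0 < q" "q < 1"
    and \<alpha>: "0 \<le> \<alpha>" "\<alpha> \<le> 1"
    and r: "1 \<le> r"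
  shows "q_numerical_radius (complex_of_real q) S powr (2 * r) \<le>
      q\<^sup>2 * norm (\<alpha> *\<^sub>R op_powr (op_abs S) (2 * r)
               + (1 - \<alpha>) *\<^sub>R op_powr (op_abs (cadjoint S)) (2 * r))
    + (1 - q\<^sup>2) * (\<alpha> * norm (op_powr (op_abs S) (2 * r))
                 + (1 - \<alpha>) * norm (op_powr (op_abs (cadjoint S)) (2 * r)))
    + 2 * q * sqrt (1 - q\<^sup>2)
        * norm (op_powr (op_abs (cadjoint S)) (2 * r * (1 - \<alpha>)))
        * norm (op_powr (op_abs S) (2 * r * \<alpha>))"
    (is "_ \<le> ?R")
proof -
  define A B where "A = op_powr (op_abs S) (2 * r)" and "B = op_powr (op_abs (cadjoint S)) (2 * r)"
  define N where "N = norm (op_powr (op_abs (cadjoint S)) (2 * r * (1 - \<alpha>)))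
      * norm (op_powr (op_abs S) (2 * r * \<alpha>))"
  define W where "W = {cmod (cinner (blinfun_apply S x) y) | x y.
      norm x = 1 \<and> norm y = 1 \<and> cinner x y = complex_of_real q}"
  define s where "s = sqrt (1 - q\<^sup>2)"
  have S': "complex_linear_op (cadjoint S)" by (rule complex_linear_op_cadjoint[OF S])
  have "q\<^sup>2 < 1" using q by (simp add: power_less_one_iff)
  then have s: "0 \<le> s" "s\<^sup>2 = 1 - q\<^sup>2" by (simp_all add: s_def)
  obtain u y0 :: 'a where u: "norm u = 1" "norm y0 = 1" "cinner u y0 = complex_of_real q"
    using q_numerical_pair_exists[OF dim, of q] q by auto
  \<comment> \<open>The exponents of the two factors of \<open>N\<close> add up to
    \<open>2 * r\<close>, and \<open>S\<close> and its adjoint have the same norm, so both sides are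
    that power of \<open>norm S\<close>.\<close>
  have "norm B = N"
  proof -
    have nS: "norm (op_powr (op_abs S) t) = powr0 t (norm S)"
      and nS': "norm (op_powr (op_abs (cadjoint S)) t) = powr0 t (norm S)" if "0 \<le> t" for t
      using norm_op_powr[OF positive_op_abs[OF S] that u(1)]
        norm_op_powr[OF positive_op_abs[OF S'] that u(1)]
      by (simp_all only: norm_op_abs[OF S] norm_op_abs[OF S'] norm_cadjoint[OF S])
    define a b where ab_def: "a = 2 * r * (1 - \<alpha>)" "b = 2 * r * \<alpha>"
    have ab: "0 \<le> a" "0 \<le> b" "2 * r = a + b"
      using \<alpha> r by (auto simp: ab_def algebra_simps)
    have "norm B = powr0 (a + b) (norm S)"
      unfolding B_def ab(3) using ab(1,2) by (intro nS') simp
    also have "\<dots> = N"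
      unfolding N_def ab_def[symmetric] nS[OF ab(2)] nS'[OF ab(1)] by (rule powr0_add[OF ab(1,2)])
    finally show ?thesis .
  qed
  have R: "?R = q\<^sup>2 * norm (\<alpha> *\<^sub>R A + (1 - \<alpha>) *\<^sub>R B) + s\<^sup>2 * (\<alpha> * norm A + (1 - \<alpha>) * norm B)
      + 2 * q * s * N"
    by (simp add: s A_def B_def N_def s_def[symmetric] mult.assoc)
  \<comment> \<open>Needed at the end, where taking the root of \<open>?R\<close> and then the power
    \<open>2 * r\<close> must return \<open>?R\<close>.\<close>
  have "0 \<le> ?R"
    unfolding R using \<alpha> q s(1) \<open>norm B = N\<close> by (intro add_nonneg_nonneg mult_nonneg_nonneg) auto
  have le: "m powr (2 * r) \<le> ?R" and m0: "0 \<le> m" if "m \<in> W" for m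
  proof -
    from that obtain x y where m: "m = cmod (cinner (blinfun_apply S x) y)"
      and x: "norm x = 1" and y: "norm y = 1" and xy: "cinner x y = complex_of_real q"
      by (auto simp: W_def)
    show "0 \<le> m" by (simp add: m)
    have "m \<le> norm (blinfun_apply S x)"
      using cmod_cinner_le[of "blinfun_apply S x" y] y by (simp add: m)
    then have mA: "m powr (2 * r) \<le> Re (cinner (blinfun_apply A x) x)"
      using norm_powr_le_cinner_op_abs[OF S x r] \<open>0 \<le> m\<close> r powr_mono2[of "2 * r" m]
      by (fastforce simp: A_def)
    have "m \<le> norm (blinfun_apply (cadjoint S) y)"
      using cmod_cinner_le[of x "blinfun_apply (cadjoint S) y"] x by (simp add: m cinner_cadjoint[OF S])
    then have mB: "m powr (2 * r) \<le> Re (cinner (blinfun_apply B y) y)"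
      using norm_powr_le_cinner_op_abs[OF S' y r] \<open>0 \<le> m\<close> r powr_mono2[of "2 * r" m]
      by (fastforce simp: B_def)
    have "m powr (2 * r) = \<alpha> * m powr (2 * r) + (1 - \<alpha>) * m powr (2 * r)"
      by (simp add: algebra_simps)
    also have "\<dots> \<le> \<alpha> * Re (cinner (blinfun_apply A x) x) + (1 - \<alpha>) * Re (cinner (blinfun_apply B y) y)"
      using mA mB \<alpha> by (intro add_mono mult_left_mono) auto
    also have "\<dots> \<le> \<alpha> * (q\<^sup>2 * Re (cinner (blinfun_apply A x) x) + s\<^sup>2 * norm A)
        + (1 - \<alpha>) * (q\<^sup>2 * Re (cinner (blinfun_apply B x) x) + s\<^sup>2 * norm B + 2 * q * s * norm B)"
    \<comment> \<open>Only the form of \<open>B\<close> is moved from \<open>y\<close> to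
      \<open>x\<close>. That of \<open>A\<close> is already at \<open>x\<close> and is split into
      its \<open>q\<^sup>2\<close> and \<open>s\<^sup>2\<close> parts, so the mixed term appears
      with weight \<open>1 - \<alpha>\<close> only.\<close>
    proof (intro add_mono mult_left_mono)
      have "Re (cinner (blinfun_apply A x) x) =
          q\<^sup>2 * Re (cinner (blinfun_apply A x) x) + s\<^sup>2 * Re (cinner (blinfun_apply A x) x)"
        by (simp add: s algebra_simps)
      then show "Re (cinner (blinfun_apply A x) x) \<le> q\<^sup>2 * Re (cinner (blinfun_apply A x) x) + s\<^sup>2 * norm A"
        using mult_left_mono[OF Re_cinner_blinfun_le[OF x x, of A], of "s\<^sup>2"] by simp
    qed (use Re_cinner_q_pair_le[OF x y xy q, of B] \<alpha> in \<open>simp_all add: s(2) s_def[symmetric]\<close>)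
    also have "\<dots> = q\<^sup>2 * Re (cinner (blinfun_apply (\<alpha> *\<^sub>R A + (1 - \<alpha>) *\<^sub>R B) x) x)
        + s\<^sup>2 * (\<alpha> * norm A + (1 - \<alpha>) * norm B) + (1 - \<alpha>) * (2 * q * s * N)"
      unfolding \<open>norm B = N\<close> by (simp add: blinfun.bilinear_simps cinner_simps algebra_simps)
    \<comment> \<open>The weight \<open>1 - \<alpha>\<close> of the mixed term is enlarged to
      1.\<close>
    also have "\<dots> \<le> ?R"
      unfolding R using Re_cinner_blinfun_le[OF x x] \<alpha> q s(1) \<open>norm B = N\<close>
      by (intro add_mono mult_left_mono order_refl mult_left_le_one_le mult_nonneg_nonneg) auto
    finally show "m powr (2 * r) \<le> ?R" .
  qed
  \<comment> \<open>Taking roots gives an upper bound on \<open>W\<close> itself, which passes to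
    the supremum before the power \<open>2 * r\<close> is restored.\<close>
  have bound: "m \<le> ?R powr (1 / (2 * r))" if "m \<in> W" for m
    using powr_mono2[OF _ _ le[OF that], of "1 / (2 * r)"] m0[OF that] r by (simp add: powr_powr)
  have w: "cmod (cinner (blinfun_apply S u) y0) \<in> W" using u by (auto simp: W_def)
  have "Sup W \<le> ?R powr (1 / (2 * r))" using w bound by (intro cSup_least) auto
  moreover have "0 \<le> Sup W"
    using m0[OF w] cSup_upper[OF w] bound by (meson bdd_aboveI order_trans)
  ultimately have "Sup W powr (2 * r) \<le> (?R powr (1 / (2 * r))) powr (2 * r)"
    using r by (intro powr_mono2) auto
  also have "\<dots> = ?R" using r \<open>0 \<le> ?R\<close> by (simp add: powr_powr)
  finally show ?thesis by (simp add: q_numerical_radius_def W_def)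
qed

end
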